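(* Let $n$ be a positive integer, $p>0$, and let $a,b,c,\nu$ be real with $c>b>0$. Then $$F_{p,\nu}(a,b;c;z)=\frac{(-z)^{-a}}{B(b,c-b)}\sum_{k=0}^{n-1}\frac{(a)_k}{k!}\, z^{-k}\, B_\nu(b-a-k,c-b;p)+O(z^{-n})$$ for $|z|\to\infty$ in $|\arg(-z)|<\pi$.
   Context: $K_\mu(z)$ denotes the modified Bessel function of the second kind of order $\mu$; $B(x,y)$ (two arguments) is the classical Beta function; $(a)_k$ is the Pochhammer symbol $(a)_0=1$, $(a)_k=a(a+1)\cdots(a+k-1)$. For $p>0$ and any $x,y,\nu$ the extended Beta function is $$B_{\nu}(x,y;p):= \sqrt{\frac{2p}{\pi}}\int_{0}^{1} t^{x-\frac{3}{2}}(1-t)^{y-\frac{3}{2}}\, K_{\nu+\frac{1}{2}}\left(\frac{p}{t(1-t)}\right)dt .$$ For $\Re(c)>\Re(b)>0$, $$F_{p,\nu}(a,b;c;z):=\sum_{n=0}^\infty(a)_n\,\frac{B_{\nu}(b+n,c-b;p)}{B(b,c-b)}\,\frac{z^n}{n!}\quad(|z|<1),$$ extended to $|\arg(1-z)|<\pi$ (i.e. $z\in\mathbb{C}\setminus[1,\infty)$) by the integral representation $$F_{p,\nu}(a,b;c;z)=\sqrt{\frac{2p}{\pi}}\,\frac{1}{B(b,c-b)}\int_0^1 t^{b-\frac{3}{2}}(1-t)^{c-b-\frac{3}{2}}(1-zt)^{-a}\, K_{\nu+\frac{1}{2}}\left(\frac{p}{t(1-t)}\right)dt.$$ Powers take principal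 values. The $O$-estimate is understood for $|\arg(-z)|\le\pi-\epsilon$ with $\epsilon>0$; the implied constant becomes infinite as $\epsilon\to0$.
   Formalization: The error term O(z^{-n}) is proved as printed only for a ≥ 0; for general real a it is O((-z)^{-a} z^{-n}), since the printed form fails for a < 0 (with a = -1, n = 1 the remainder is the nonzero constant B_ν(b,c-b;p)/B(b,c-b)). *)

theory Defs
  imports "HOL-Analysis.Analysis" "HOL-Library.Landau_Symbols"
begin

text \<open>
  The modified Bessel function of the second kind of order \<open>\<mu>\<close>, in the half-plane \<open>Re z > 0\<close>, by
  its classical integral representation (Schlaefli; DLMF 10.32.9).
\<close>

definition bessel_K :: "complex \<Rightarrow> complex \<Rightarrow> complex" where
  "bessel_K \<mu> z =
     (LINT s:{0<..}|lborel. exp (- z * of_real (cosh s)) * cosh (\<mu> * of_real s))"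

definition ext_Beta :: "complex \<Rightarrow> complex \<Rightarrow> complex \<Rightarrow> real \<Rightarrow> complex" where
  "ext_Beta \<nu> x y p =
     of_real (sqrt (2 * p / pi)) *
     (LINT t:{0<..<1}|lborel.
        of_real t powr (x - 3/2) * of_real (1 - t) powr (y - 3/2) *
        bessel_K (\<nu> + 1/2) (of_real (p / (t * (1 - t)))))"

definition ext_hyp_series ::
    "real \<Rightarrow> complex \<Rightarrow> complex \<Rightarrow> complex \<Rightarrow> complex \<Rightarrow> complex \<Rightarrow> complex" where
  "ext_hyp_series p \<nu> a b c z =
     (\<Sum>n. pochhammer a n * (ext_Beta \<nu> (b + of_nat n) (c - b) p / Beta b (c - b)) *
          (z ^ n / fact n))"

definition ext_hyp_integral ::
    "real \<Rightarrow> complex \<Rightarrow> complex \<Rightarrow> complex \<Rightarrow> complex \<Rightarrow> complex \<Rightarrow> complex" where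
  "ext_hyp_integral p \<nu> a b c z =
     of_real (sqrt (2 * p / pi)) * (1 / Beta b (c - b)) *
     (LINT t:{0<..<1}|lborel.
        of_real t powr (b - 3/2) * of_real (1 - t) powr (c - b - 3/2) *
        (1 - z * of_real t) powr (- a) *
        bessel_K (\<nu> + 1/2) (of_real (p / (t * (1 - t)))))"

text \<open>
  \<open>F\<^sub>p\<^sub>,\<^sub>\<nu>(a,b;c;z)\<close>, meaningful for \<open>p > 0\<close>, \<open>Re c > Re b > 0\<close> and \<open>z\<close> outside the cut
  \<open>[1,\<infinity>)\<close>.
\<close>

definition ext_hyp ::
    "real \<Rightarrow> complex \<Rightarrow> complex \<Rightarrow> complex \<Rightarrow> complex \<Rightarrow> complex \<Rightarrow> complex" where
  "ext_hyp p \<nu> a b c z =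
     (if norm z < 1 then ext_hyp_series p \<nu> a b c z else ext_hyp_integral p \<nu> a b c z)"

text \<open>Here \<open>z \<rightarrow> \<infinity>\<close> inside the closed sector \<open>\<bar>arg(-z)\<bar> \<le> \<pi> - \<epsilon>\<close>.\<close>

definition at_infinity_sector :: "real \<Rightarrow> complex filter" where
  "at_infinity_sector \<epsilon> = inf at_infinity (principal {z. \<bar>Arg (- z)\<bar> \<le> pi - \<epsilon>})"

end

theory Submission
  imports Defs
begin

text \<open>
  With \<open>w = 1/(zt)\<close>, the integrand of \<open>F\<^sub>p\<^sub>,\<^sub>\<nu>\<close> factors through
  \<open>(1 - zt)\<^bsup>-a\<^esup> = (-z)\<^bsup>-a\<^esup> t\<^bsup>-a\<^esup> (1 - w)\<^bsup>-a\<^esup>\<close>, and integrating the binomial expansion of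
  \<open>(1 - w)\<^bsup>-a\<^esup>\<close> term by term yields the asserted sum. Although \<open>w\<close> is unbounded as
  \<open>t \<rightarrow> 0\<close>, in the sector \<open>1 - w\<close> stays away from \<open>0\<close>, so the binomial remainder after \<open>n\<close> terms is
  at most \<open>C |w|\<^sup>n (1 + |w|)\<^sup>m\<close> for some \<open>m\<close>. The resulting power \<open>t\<^bsup>-n-m\<^esup>\<close> is harmless, because
  \<open>K\<^sub>\<mu>(p/(t(1-t)))\<close> vanishes to every order at both end points.
\<close>

section \<open>Binomial series and its remainder\<close>

lemma one_minus_powr_sums:
  fixes w a :: complex
  assumes "norm w < 1"
  shows "(\<lambda>k. pochhammer a k / fact k * w ^ k) sums (1 - w) powr (- a)"
proof -
  have "(\<lambda>k. ((- a) gchoose k) * (- w) ^ k) sums (1 + (- w)) powr (- a)"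
    using assms by (intro gen_binomial_complex) auto
  moreover have "((- a) gchoose k) * (- w) ^ k = pochhammer a k / fact k * w ^ k" for k
    unfolding gbinomial_pochhammer power_minus[of w] by (simp add: mult_ac)
  ultimately show ?thesis by simp
qed

text \<open>The remainder is the tail of the series. Factoring \<open>w ^ n\<close> out of it leaves
  a power series that is majorized, uniformly in the disc, by its series of norms at radius
  1/2.\<close>

lemma one_minus_powr_remainder_small:
  fixes a :: complex
  obtains C where "C \<ge> 0" and "\<And>w. norm w \<le> 1/2 \<Longrightarrow>
    norm ((1 - w) powr (- a) - (\<Sum>k<n. pochhammer a k / fact k * w ^ k)) \<le> C * norm w ^ n"
proof -
  define f where "f k = pochhammer a k / fact k" for k
  \<comment> \<open>Any point strictly between 1/2 and the radius of convergence 1 would do: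
    convergence there forces absolute convergence at 1/2.\<close>
  have "summable (\<lambda>k. f k * (3/4) ^ k)"
    using one_minus_powr_sums[of "3/4" a] by (auto simp: f_def sums_iff)
  then have "summable (\<lambda>k. norm (f k * (1/2) ^ k))"
    by (rule powser_insidea) auto
  then have "summable (\<lambda>k. norm (f (k + n)) * (1/2) ^ (k + n))"
    by (subst summable_iff_shift) (simp add: norm_mult norm_power)
  then have "summable (\<lambda>k. 2 ^ n * (norm (f (k + n)) * (1/2) ^ (k + n)))"
    by (rule summable_mult)
  then have sm: "summable (\<lambda>k. norm (f (k + n)) * (1/2) ^ k)"
    by (simp add: power_add field_simps)
  show thesis
  proof
    show "(\<Sum>k. norm (f (k + n)) * (1/2) ^ k) \<ge> 0"
      using sm by (intro suminf_nonneg) auto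
    fix w :: complex assume w: "norm w \<le> 1/2"
    have s: "(\<lambda>k. f k * w ^ k) sums (1 - w) powr (- a)"
      unfolding f_def by (intro one_minus_powr_sums) (use w in auto)
    have smw: "summable (\<lambda>k. norm (f (k + n) * w ^ k))"
      by (rule summable_comparison_test'[OF sm, of 0])
        (use w in \<open>auto simp: norm_mult norm_power intro!: mult_left_mono power_mono\<close>)
    have "(1 - w) powr (- a) - (\<Sum>k<n. f k * w ^ k) = (\<Sum>k. f (k + n) * w ^ (k + n))"
      using suminf_split_initial_segment[of "\<lambda>k. f k * w ^ k" n] s by (auto simp: sums_iff)
    also have "\<dots> = (\<Sum>k. w ^ n * (f (k + n) * w ^ k))"
      by (simp add: power_add mult_ac)
    also have "\<dots> = w ^ n * (\<Sum>k. f (k + n) * w ^ k)"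
      by (rule suminf_mult) (rule summable_norm_cancel[OF smw])
    also have "norm \<dots> = norm w ^ n * norm (\<Sum>k. f (k + n) * w ^ k)"
      by (simp add: norm_mult norm_power)
    also have "\<dots> \<le> norm w ^ n * (\<Sum>k. norm (f (k + n) * w ^ k))"
      by (intro mult_left_mono summable_norm smw) auto
    also have "\<dots> \<le> norm w ^ n * (\<Sum>k. norm (f (k + n)) * (1/2) ^ k)"
      by (intro mult_left_mono suminf_le smw sm)
        (use w in \<open>auto simp: norm_mult norm_power intro!: mult_left_mono power_mono\<close>)
    finally show "norm ((1 - w) powr (- a) - (\<Sum>k<n. pochhammer a k / fact k * w ^ k))
        \<le> (\<Sum>k. norm (f (k + n)) * (1/2) ^ k) * norm w ^ n"
      by (simp add: f_def mult_ac)
  qed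
qed

text \<open>Near 0 the series estimate applies. For |w| > 1/2 no cancellation is used: power and
  partial sum are bounded separately, and \<open>(2 * norm w) ^ n\<close>, being at least 1,
  supplies the factor |w|^n. The distance \<delta> from the branch point w = 1 controls the power
  when a \<ge> 0, and \<open>(1 + norm w) ^ m\<close> controls its growth when a < 0.\<close>

lemma one_minus_powr_remainder_le:
  fixes a \<delta> :: real
  assumes "\<delta> > 0" and "\<bar>a\<bar> \<le> real m"
  obtains C where "C \<ge> 0" and "\<And>w :: complex. \<delta> \<le> norm (1 - w) \<Longrightarrow>
    norm ((1 - w) powr (- of_real a) - (\<Sum>k<n. pochhammer (of_real a) k / fact k * w ^ k))
      \<le> C * norm w ^ n * (1 + norm w) ^ m"
proof -
  define f :: "nat \<Rightarrow> complex" where "f k = pochhammer (of_real a) k / fact k" for k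
  obtain C1 where C1: "C1 \<ge> 0" "\<And>w. norm w \<le> 1/2 \<Longrightarrow>
      norm ((1 - w) powr (- of_real a) - (\<Sum>k<n. f k * w ^ k)) \<le> C1 * norm w ^ n"
    using one_minus_powr_remainder_small[where a = "of_real a" and n = n] unfolding f_def by blast
  \<comment> \<open>The first summand serves a \<ge> 0, the second a < 0, the third the partial sum;
    \<open>2 ^ n\<close> is what \<open>(2 * norm w) ^ n\<close> contributes beyond |w|^n.\<close>
  define C2 where "C2 = (\<delta> powr (- a) + 1 + (\<Sum>k<n. norm (f k))) * 2 ^ n"
  have C2: "C2 \<ge> 0"
    unfolding C2_def by (intro mult_nonneg_nonneg add_nonneg_nonneg sum_nonneg) auto
  show thesis
  proof
    show "C1 + C2 \<ge> 0" using C1 C2 by simp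
    fix w :: complex assume w: "\<delta> \<le> norm (1 - w)"
    have one: "1 \<le> (1 + norm w) ^ m" by (rule one_le_power) auto
    have "norm ((1 - w) powr (- of_real a) - (\<Sum>k<n. f k * w ^ k))
        \<le> (C1 + C2) * norm w ^ n * (1 + norm w) ^ m"
    proof (cases "norm w \<le> 1/2")
      case True
      have "C1 * norm w ^ n * 1 \<le> (C1 + C2) * norm w ^ n * (1 + norm w) ^ m"
        using C1 C2 one by (intro mult_mono) auto
      then show ?thesis using C1(2)[OF True] by simp
    next
      case False
      have le: "norm (1 - w) \<le> 1 + norm w"
        using norm_triangle_ineq4[of 1 w] by simp
      have big: "1 \<le> (2 * norm w) ^ n"
        using False by (intro one_le_power) auto
      have "norm (1 - w) powr (- a) \<le> (\<delta> powr (- a) + 1) * (1 + norm w) ^ m"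
      proof (cases "a \<ge> 0")
        case True
        have "norm (1 - w) powr (- a) \<le> \<delta> powr (- a)"
          using w assms True by (intro powr_mono2') auto
        also have "\<dots> \<le> (\<delta> powr (- a) + 1) * (1 + norm w) ^ m"
          using mult_mono[of "\<delta> powr (- a)" "\<delta> powr (- a) + 1" 1 "(1 + norm w) ^ m"] one by simp
        finally show ?thesis .
      next
        case False
        have "norm (1 - w) powr (- a) \<le> (1 + norm w) powr (- a)"
          using False le by (intro powr_mono2) auto
        also have "\<dots> \<le> (1 + norm w) powr (real m)"
          using assms by (intro powr_mono) auto
        also have "\<dots> = (1 + norm w) ^ m"
          by (rule powr_realpow) (simp add: add_pos_nonneg)
        also have "\<dots> \<le> (\<delta> powr (- a) + 1) * (1 + norm w) ^ m"
          using mult_right_mono[of 1 "\<delta> powr (- a) + 1" "(1 + norm w) ^ m"] by simp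
        finally show ?thesis .
      qed
      also have "\<dots> \<le> (\<delta> powr (- a) + 1) * (1 + norm w) ^ m * (2 * norm w) ^ n"
        using mult_left_mono[OF big, of "(\<delta> powr (- a) + 1) * (1 + norm w) ^ m"] by simp
      finally have 1: "norm (1 - w) powr (- a)
          \<le> (\<delta> powr (- a) + 1) * (1 + norm w) ^ m * (2 * norm w) ^ n" .
      have "(\<Sum>k<n. norm (f k) * norm w ^ k) \<le> (\<Sum>k<n. norm (f k) * (2 * norm w) ^ n)"
      proof (intro sum_mono mult_left_mono)
        fix k assume "k \<in> {..<n}"
        have "norm w ^ k \<le> (2 * norm w) ^ k" by (intro power_mono) auto
        also have "\<dots> \<le> (2 * norm w) ^ n"
          using False \<open>k \<in> {..<n}\<close> by (intro power_increasing) auto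
        finally show "norm w ^ k \<le> (2 * norm w) ^ n" .
      qed auto
      also have "\<dots> = (\<Sum>k<n. norm (f k)) * 1 * (2 * norm w) ^ n"
        by (simp add: sum_distrib_right)
      also have "\<dots> \<le> (\<Sum>k<n. norm (f k)) * (1 + norm w) ^ m * (2 * norm w) ^ n"
        using one by (intro mult_right_mono mult_left_mono sum_nonneg) auto
      finally have 2: "(\<Sum>k<n. norm (f k) * norm w ^ k)
          \<le> (\<Sum>k<n. norm (f k)) * (1 + norm w) ^ m * (2 * norm w) ^ n" .
      have "norm ((1 - w) powr (- of_real a) - (\<Sum>k<n. f k * w ^ k))
          \<le> norm ((1 - w) powr (- of_real a)) + norm (\<Sum>k<n. f k * w ^ k)"
        by (rule norm_triangle_ineq4)
      \<comment> \<open>Since the exponent is real, the argument of 1 - w does not affect the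
        norm.\<close>
      also have "norm ((1 - w) powr (- of_real a)) = norm (1 - w) powr (- a)"
        by (subst norm_powr_real_powr') auto
      also have "norm (\<Sum>k<n. f k * w ^ k) \<le> (\<Sum>k<n. norm (f k) * norm w ^ k)"
        by (rule order_trans[OF norm_sum]) (simp add: norm_mult norm_power)
      also have "norm (1 - w) powr (- a) + (\<Sum>k<n. norm (f k) * norm w ^ k)
          \<le> C2 * norm w ^ n * (1 + norm w) ^ m"
        using 1 2 unfolding C2_def by (simp add: algebra_simps power_mult_distrib)
      also have "\<dots> \<le> (C1 + C2) * norm w ^ n * (1 + norm w) ^ m"
        using C1 by (intro mult_right_mono) auto
      finally show ?thesis by simp
    qed
    then show "norm ((1 - w) powr (- of_real a)
          - (\<Sum>k<n. pochhammer (of_real a) k / fact k * w ^ k))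
        \<le> (C1 + C2) * norm w ^ n * (1 + norm w) ^ m"
      by (simp add: f_def)
  qed
qed

section \<open>Decay of the Bessel function and integrability of the kernel\<close>

lemma power_over_fact_le_exp:
  fixes x :: real
  assumes "x \<ge> 0"
  shows "x ^ n / fact n \<le> exp x"
  using sum_le_suminf[of "\<lambda>k. x ^ k / fact k" "{n}"] exp_converges[of x] assms
  by (simp add: sums_iff divide_inverse mult.commute)

text \<open>With x = u e^s / 2 \<le> u cosh s, the bound e^(-x) \<le> N! / x^N produces both u^(-N)
  and e^(-N s). The latter beats cosh (\<mu> s) \<le> e^(|\<mu>| s) because N > |\<mu>|, so the
  integral over s converges. N may be as large as desired, which is the decay required at both end
  points t = 0 and t = 1.\<close>

lemma bessel_K_le:
  fixes \<mu> :: real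
  assumes "\<bar>\<mu>\<bar> < real N"
  obtains C where "C \<ge> 0" and "\<And>u. u > 0 \<Longrightarrow> norm (bessel_K (of_real \<mu>) (of_real u)) \<le> C / u ^ N"
proof -
  define d where "d = real N - \<bar>\<mu>\<bar>"
  have d: "d > 0" using assms by (simp add: d_def)
  \<comment> \<open>The gauge integral is turned into a Lebesgue integral: nonnegativity makes it
    absolute, and Borel measurability allows the passage from the completed measure to
    \<open>lborel\<close>.\<close>
  have "(\<lambda>s. exp (- d * s)) integrable_on {0..}"
    by (rule integrable_on_exp_minus_to_infinity[OF d])
  then have "(\<lambda>s. exp (- d * s)) absolutely_integrable_on {0..}"
    by (intro nonnegative_absolutely_integrable_1) auto
  then have "set_integrable lborel {0..} (\<lambda>s. exp (- d * s))"
    unfolding set_integrable_def by (subst (asm) integrable_completion) auto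
  then have I: "set_integrable lborel {0<..} (\<lambda>s. exp (- d * s))"
    by (rule set_integrable_subset) auto
  define C where "C = fact N * 2 ^ N * (LINT s:{0<..}|lborel. exp (- d * s))"
  show thesis
  proof
    show "C \<ge> 0"
      unfolding C_def set_lebesgue_integral_def
      by (intro mult_nonneg_nonneg integral_nonneg) auto
    fix u :: real assume u: "u > 0"
    have pt: "norm (exp (- of_real u * of_real (cosh s)) * cosh (of_real \<mu> * complex_of_real s))
        \<le> fact N * 2 ^ N / u ^ N * exp (- d * s)" if s: "s > 0" for s
    proof -
      have x: "u * exp s / 2 > 0" using u by simp
      have "exp s / 2 \<le> cosh s" by (simp add: cosh_def)
      then have "u * (exp s / 2) \<le> u * cosh s" using u by (intro mult_left_mono) auto
      then have "exp (- (u * cosh s)) \<le> exp (- (u * exp s / 2))"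
        by simp
      also have "\<dots> \<le> fact N / (u * exp s / 2) ^ N"
      proof -
        have "(u * exp s / 2) ^ N / fact N \<le> exp (u * exp s / 2)"
          using x by (intro power_over_fact_le_exp) auto
        then show ?thesis
          using zero_less_power[OF x, of N] unfolding exp_minus
          by (subst pos_le_divide_eq) (simp_all add: divide_simps mult.commute)
      qed
      finally have 1: "exp (- (u * cosh s)) \<le> fact N * 2 ^ N / u ^ N * exp (- (real N * s))"
        by (simp add: power_mult_distrib power_divide exp_minus field_simps flip: exp_of_nat_mult)
      have 2: "cosh (\<mu> * s) \<le> exp (\<bar>\<mu>\<bar> * s)"
      proof -
        have "exp (\<mu> * s) \<le> exp (\<bar>\<mu>\<bar> * s)" "exp (- (\<mu> * s)) \<le> exp (\<bar>\<mu>\<bar> * s)"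
          using s by (auto simp: abs_mult intro: order_trans[OF abs_ge_self] )
        then have "exp (\<mu> * s) + exp (- (\<mu> * s)) \<le> 2 * exp (\<bar>\<mu>\<bar> * s)"
          by linarith
        then show ?thesis by (simp add: cosh_field_def)
      qed
      have "norm (exp (- of_real u * of_real (cosh s)) * cosh (of_real \<mu> * complex_of_real s))
          = exp (- (u * cosh s)) * cosh (\<mu> * s)"
        by (simp add: norm_mult cosh_def scaleR_conv_of_real exp_of_real norm_divide
            flip: of_real_mult of_real_add of_real_minus)
      also have "\<dots> \<le> (fact N * 2 ^ N / u ^ N * exp (- (real N * s))) * exp (\<bar>\<mu>\<bar> * s)"
        using 1 2 u by (intro mult_mono) auto
      also have "\<dots> = fact N * 2 ^ N / u ^ N * exp (- d * s)"
        by (simp add: d_def algebra_simps flip: exp_add)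
      finally show ?thesis .
    qed
    have "norm (bessel_K (of_real \<mu>) (of_real u)) \<le>
        (LINT s|lborel. norm (indicator {0<..} s *\<^sub>R
           (exp (- of_real u * of_real (cosh s)) * cosh (of_real \<mu> * complex_of_real s))))"
      unfolding bessel_K_def set_lebesgue_integral_def by (rule integral_norm_bound)
    also have "\<dots> \<le> (LINT s|lborel. fact N * 2 ^ N / u ^ N * (indicator {0<..} s *\<^sub>R exp (- d * s)))"
    proof (rule integral_mono')
      show "integrable lborel (\<lambda>s. fact N * 2 ^ N / u ^ N * (indicator {0<..} s *\<^sub>R exp (- d * s)))"
        using I unfolding set_integrable_def by (rule integrable_mult_right)
    qed (use pt u in \<open>auto simp: indicator_def\<close>)
    also have "\<dots> = C / u ^ N"
      by (simp add: C_def set_lebesgue_integral_def)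
    finally show "norm (bessel_K (of_real \<mu>) (of_real u)) \<le> C / u ^ N" .
  qed
qed

lemma borel_measurable_bessel_K [measurable]:
  "(\<lambda>u. bessel_K \<mu> (complex_of_real u)) \<in> borel_measurable borel"
proof -
  have [measurable]: "(\<lambda>s. cosh (\<mu> * complex_of_real s)) \<in> borel_measurable borel"
    "(cosh :: real \<Rightarrow> real) \<in> borel_measurable borel"
    by (intro borel_measurable_continuous_onI continuous_intros)+
  show ?thesis
    unfolding bessel_K_def set_lebesgue_integral_def by measurable
qed

text \<open>The integrand of \<open>ext_Beta\<close> with the -3/2 absorbed into both exponents.
  Powers are taken over the reals, so that norms are immediate. The exponent of t is the last
  argument before t because only it varies: multiplication by 1/t shifts it by one.\<close>

definition ext_Beta_kernel :: "real \<Rightarrow> real \<Rightarrow> complex \<Rightarrow> real \<Rightarrow> real \<Rightarrow> complex" where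
  "ext_Beta_kernel p y \<mu> x t =
     of_real (t powr x * (1 - t) powr y) * bessel_K \<mu> (of_real (p / (t * (1 - t))))"

text \<open>However negative x and y are, the Bessel bound with N > |\<mu>|, -x, -y contributes (t
  (1 - t))^N, which cancels both end point singularities. The kernel is thus bounded on the unit
  interval.\<close>

lemma set_integrable_ext_Beta_kernel:
  fixes p x y \<mu> :: real
  assumes "p > 0"
  shows "set_integrable lborel {0<..<1} (ext_Beta_kernel p y (of_real \<mu>) x)"
proof -
  obtain N :: nat where N: "real N > max \<bar>\<mu>\<bar> (max (- x) (- y))"
    using reals_Archimedean2 by blast
  obtain C where C: "C \<ge> 0" "\<And>u. u > 0 \<Longrightarrow> norm (bessel_K (of_real \<mu>) (of_real u)) \<le> C / u ^ N"
    using bessel_K_le[of \<mu> N] N by auto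
  show ?thesis
  proof (rule set_integrable_bound)
    show "set_integrable lborel {0<..<1::real} (\<lambda>_. C / p ^ N)"
      by (auto simp: set_integrable_def)
    show "set_borel_measurable lborel {0<..<1} (ext_Beta_kernel p y (of_real \<mu>) x)"
      unfolding set_borel_measurable_def ext_Beta_kernel_def by measurable
    have "norm (ext_Beta_kernel p y (of_real \<mu>) x t) \<le> C / p ^ N" if t: "t \<in> {0<..<1}" for t
    proof -
      have "norm (bessel_K (of_real \<mu>) (of_real (p / (t * (1 - t))))) \<le> C / (p / (t * (1 - t))) ^ N"
        using t assms by (intro C) auto
      also have "\<dots> = C / p ^ N * (t powr real N * (1 - t) powr real N)"
        using t by (simp add: powr_realpow power_divide power_mult_distrib)
      finally have "norm (ext_Beta_kernel p y (of_real \<mu>) x t)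
          \<le> (t powr x * (1 - t) powr y) * (C / p ^ N * (t powr real N * (1 - t) powr real N))"
        unfolding ext_Beta_kernel_def norm_mult norm_of_real
        by (intro mult_mono) auto
      also have "\<dots> = C / p ^ N * (t powr (x + real N) * (1 - t) powr (y + real N))"
        by (simp add: powr_add mult_ac)
      also have "\<dots> \<le> C / p ^ N * (1 * 1)"
        using t N C assms by (intro mult_left_mono mult_mono powr_le1) auto
      finally show ?thesis by simp
    qed
    then show "AE t in lborel. t \<in> {0<..<1} \<longrightarrow>
        norm (ext_Beta_kernel p y (of_real \<mu>) x t) \<le> norm (C / p ^ N)"
      using C assms by auto
  qed
qed

section \<open>Geometry of the sector and branches of the power\<close>

lemma norm_one_plus_sector_ge:
  fixes u :: complex
  assumes "\<bar>Arg u\<bar> \<le> pi - \<epsilon>" and "0 < \<epsilon>" and "\<epsilon> \<le> pi / 2"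
  shows "norm (1 + u) \<ge> sin \<epsilon>"
proof -
  define r where "r = norm u"
  have "cos (Arg u) \<ge> - cos \<epsilon>"
  proof -
    have "cos (pi - \<epsilon>) \<le> cos \<bar>Arg u\<bar>"
      using assms by (intro cos_monotone_0_pi_le) auto
    then show ?thesis by simp
  qed
  then have "r * cos (Arg u) \<ge> r * - cos \<epsilon>"
    by (intro mult_left_mono) (auto simp: r_def)
  then have Re: "Re u \<ge> - (r * cos \<epsilon>)"
    by (metis Re_rcis minus_mult_right r_def rcis_cmod_Arg)
  \<comment> \<open>The right side is |1 + u|^2 on the boundary ray of argument \<pi> - \<epsilon>.
    It exceeds the left side by the square (r - cos \<epsilon>)^2.\<close>
  have "(sin \<epsilon>)\<^sup>2 \<le> 1 - 2 * r * cos \<epsilon> + r\<^sup>2"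
    using zero_le_power2[of "r - cos \<epsilon>"] unfolding power2_diff sin_squared_eq
    by (simp add: algebra_simps)
  also have "\<dots> \<le> 1 + 2 * Re u + r\<^sup>2" using Re by simp
  also have "\<dots> = (norm (1 + u))\<^sup>2"
    unfolding r_def cmod_power2 by (simp add: power2_eq_square algebra_simps)
  finally show ?thesis by (rule power2_le_imp_le) simp
qed

text \<open>The imaginary parts of u and 1 + 1/u have opposite signs, or both numbers are positive
  reals. The two arguments therefore add up to a value strictly between -\<pi> and \<pi>, and the
  principal logarithms add without a multiple of 2 \<pi> i.\<close>

lemma one_plus_powr_factor:
  fixes u s :: complex
  assumes "u \<notin> \<real>\<^sub>\<le>\<^sub>0"
  shows "(1 + u) powr s = u powr s * (1 + inverse u) powr s"
proof -
  have u: "u \<noteq> 0" using assms by auto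
  have v: "1 + inverse u \<noteq> 0"
  proof
    assume "1 + inverse u = 0"
    then have "u = -1" using u by (simp add: field_simps add_eq_0_iff)
    then show False using assms by simp
  qed
  have "- pi < Arg u + Arg (1 + inverse u) \<and> Arg u + Arg (1 + inverse u) < pi"
  proof (cases "Im u" "0 :: real" rule: linorder_cases)
    case less
    then have "Im (1 + inverse u) > 0"
      by (simp add: divide_neg_pos sum_power2_gt_zero_iff)
    then show ?thesis
      using less Arg_less_0[of u] Arg_less_0[of "1 + inverse u"] mpi_less_Arg[of u] Arg_lt_pi[of "1 + inverse u"]
      by linarith
  next
    case equal
    then have "Re u > 0" using assms by (auto simp: complex_nonpos_Reals_iff)
    then have "Arg u = 0" "Arg (1 + inverse u) = 0"
      using equal by (auto simp: Arg_eq_0 complex_is_Real_iff)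
    then show ?thesis by simp
  next
    case greater
    then have "Im (1 + inverse u) < 0"
      by (simp add: divide_neg_pos sum_power2_gt_zero_iff)
    then show ?thesis
      using greater Arg_less_0[of u] Arg_less_0[of "1 + inverse u"] mpi_less_Arg[of "1 + inverse u"] Arg_lt_pi[of u]
      by linarith
  qed
  then have "Ln (u * (1 + inverse u)) = Ln u + Ln (1 + inverse u)"
    using u v by (intro Ln_times_simple) (auto simp: Arg_eq_Im_Ln)
  moreover have "u * (1 + inverse u) = 1 + u" using u by (simp add: algebra_simps)
  ultimately show ?thesis
    using u v by (metis (no_types, lifting) distrib_left exp_add mult_eq_0_iff powr_def)
qed

section \<open>Integral representations in terms of the kernel\<close>

lemma ext_Beta_eq_integral_kernel:
  fixes x y \<nu> p :: real
  shows "ext_Beta (of_real \<nu>) (of_real x) (of_real y) p = of_real (sqrt (2 * p / pi)) *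
    (LINT t:{0<..<1}|lborel. ext_Beta_kernel p (y - 3/2) (of_real (\<nu> + 1/2)) (x - 3/2) t)"
  unfolding ext_Beta_def
proof (intro arg_cong2[of _ _ _ _ "(*)"] refl set_lebesgue_integral_cong ballI allI impI)
  fix t :: real assume t: "t \<in> {0<..<1}"
  have "complex_of_real t powr (of_real x - 3/2) = of_real (t powr (x - 3/2))"
    "complex_of_real (1 - t) powr (of_real y - 3/2) = of_real ((1 - t) powr (y - 3/2))"
    using t powr_of_real[of t "x - 3/2"] powr_of_real[of "1 - t" "y - 3/2"] by simp_all
  then show "complex_of_real t powr (of_real x - 3/2) * of_real (1 - t) powr (of_real y - 3/2) *
      bessel_K (of_real \<nu> + 1/2) (of_real (p / (t * (1 - t))))
    = ext_Beta_kernel p (y - 3/2) (of_real (\<nu> + 1/2)) (x - 3/2) t"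
    by (simp add: ext_Beta_kernel_def)
qed auto

text \<open>The factorization of 1 + u is applied to u = -z t. The positive real t splits off from
  the principal power of -z t, and its power t^(-a) lowers the exponent of the kernel by a.\<close>

lemma ext_hyp_integral_eq_integral_kernel:
  fixes a b c \<nu> p :: real and z :: complex
  assumes "- z \<notin> \<real>\<^sub>\<le>\<^sub>0"
  shows "ext_hyp_integral p (of_real \<nu>) (of_real a) (of_real b) (of_real c) z =
    of_real (sqrt (2 * p / pi)) * ((- z) powr (- of_real a) / Beta (of_real b) (of_real (c - b))) *
    (LINT t:{0<..<1}|lborel. (1 - inverse (z * of_real t)) powr (- of_real a) *
       ext_Beta_kernel p (c - b - 3/2) (of_real (\<nu> + 1/2)) (b - a - 3/2) t)"
proof -
  have "(LINT t:{0<..<1}|lborel.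
      complex_of_real t powr (of_real b - 3/2) * of_real (1 - t) powr (of_real c - of_real b - 3/2) *
        (1 - z * of_real t) powr (- of_real a) *
        bessel_K (of_real \<nu> + 1/2) (of_real (p / (t * (1 - t)))))
    = (LINT t:{0<..<1}|lborel. (- z) powr (- of_real a) *
       ((1 - inverse (z * of_real t)) powr (- of_real a) *
       ext_Beta_kernel p (c - b - 3/2) (of_real (\<nu> + 1/2)) (b - a - 3/2) t))"
  proof (intro set_lebesgue_integral_cong ballI allI impI)
    fix t :: real assume t: "t \<in> {0<..<1}"
    have 1: "complex_of_real t powr (of_real b - 3/2) = of_real (t powr (b - 3/2))"
      "complex_of_real (1 - t) powr (of_real c - of_real b - 3/2) = of_real ((1 - t) powr (c - b - 3/2))"
      using t powr_of_real[of t "b - 3/2"] powr_of_real[of "1 - t" "c - b - 3/2"] by simp_all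
    have "- z * of_real t \<notin> \<real>\<^sub>\<le>\<^sub>0"
      using assms t by (auto simp: complex_nonpos_Reals_iff zero_le_mult_iff mult_le_0_iff)
    from one_plus_powr_factor[OF this, of "- of_real a"]
    have "(1 - z * of_real t) powr (- of_real a)
        = (of_real t * - z) powr (- of_real a) * (1 - inverse (z * of_real t)) powr (- of_real a)"
      by (simp add: mult_ac)
    also have "(of_real t * - z) powr (- of_real a) = of_real t powr (- of_real a) * (- z) powr (- of_real a)"
      using t by (intro powr_times_real_left) auto
    also have "complex_of_real t powr (- of_real a) = of_real (t powr (- a))"
      using t powr_of_real[of t "- a"] by simp
    finally have 2: "(1 - z * of_real t) powr (- of_real a)
      = of_real (t powr (- a)) * (- z) powr (- of_real a) * (1 - inverse (z * of_real t)) powr (- of_real a)" .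
    have 3: "t powr (b - a - 3/2) = t powr (b - 3/2) * t powr (- a)"
      by (simp add: algebra_simps flip: powr_add)
    show "complex_of_real t powr (of_real b - 3/2) * of_real (1 - t) powr (of_real c - of_real b - 3/2) *
        (1 - z * of_real t) powr (- of_real a) *
        bessel_K (of_real \<nu> + 1/2) (of_real (p / (t * (1 - t))))
      = (- z) powr (- of_real a) *
       ((1 - inverse (z * of_real t)) powr (- of_real a) *
       ext_Beta_kernel p (c - b - 3/2) (of_real (\<nu> + 1/2)) (b - a - 3/2) t)"
      unfolding 1 2 ext_Beta_kernel_def 3 by (simp add: mult_ac)
  qed auto
  then show ?thesis
    unfolding ext_hyp_integral_def by simp
qed

text \<open>This turns the k-th binomial term into z^(-k) times the integrand of the k-th extended
  Beta value. The case z = 1 handles bare powers of 1/t.\<close>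

lemma inverse_power_mult_ext_Beta_kernel:
  assumes "t > 0"
  shows "inverse (z * of_real t) ^ k * ext_Beta_kernel p y \<mu> x t
    = z powi (- int k) * ext_Beta_kernel p y \<mu> (x - real k) t"
proof -
  have "t powr (x - real k) = inverse t ^ k * t powr x"
    using assms by (simp add: powr_diff powr_realpow field_simps)
  then show ?thesis
    by (simp add: ext_Beta_kernel_def power_int_minus power_inverse power_mult_distrib)
qed

section \<open>Uniform estimate of the integrated remainder\<close>

lemma ext_hyp_integral_remainder:
  fixes a b c \<nu> p \<delta> :: real
  assumes "p > 0" and "\<delta> > 0"
  obtains C where "\<And>z. - z \<notin> \<real>\<^sub>\<le>\<^sub>0 \<Longrightarrow> norm z \<ge> 1 \<Longrightarrow>
    (\<And>t. t \<in> {0<..<1} \<Longrightarrow> \<delta> \<le> norm (1 - inverse (z * of_real t))) \<Longrightarrow>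
    norm (ext_hyp_integral p (of_real \<nu>) (of_real a) (of_real b) (of_real c) z
      - (- z) powr (- of_real a) / Beta (of_real b) (of_real (c - b)) *
        (\<Sum>k<n. pochhammer (of_real a) k / fact k * z powi (- int k) *
           ext_Beta (of_real \<nu>) (of_real (b - a - real k)) (of_real (c - b)) p))
    \<le> C * norm ((- z) powr (- of_real a) * z powi (- int n))"
proof -
  define W where "W = ext_Beta_kernel p (c - b - 3/2) (of_real (\<nu> + 1/2))"
  define S where "S = complex_of_real (sqrt (2 * p / pi))"
  define B where "B = Beta (of_real b) (complex_of_real (c - b))"
  define x where "x = b - a - 3/2"
  define f :: "nat \<Rightarrow> complex" where "f k = pochhammer (of_real a) k / fact k" for k
  define \<rho> where "\<rho> w = (1 - w) powr (- of_real a) - (\<Sum>k<n. f k * w ^ k)" for w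
  obtain m :: nat where m: "\<bar>a\<bar> \<le> real m" using real_arch_simple by blast
  obtain C where C: "C \<ge> 0"
    "\<And>w. \<delta> \<le> norm (1 - w) \<Longrightarrow> norm (\<rho> w) \<le> C * norm w ^ n * (1 + norm w) ^ m"
    using one_minus_powr_remainder_le[OF assms(2) m, of n] unfolding \<rho>_def f_def by blast
  have W: "set_integrable lborel {0<..<1} (W x')" for x'
    unfolding W_def by (rule set_integrable_ext_Beta_kernel[OF assms(1)])
  \<comment> \<open>For |z| \<ge> 1 one has 1 + |w| \<le> 2/t, whence \<open>2 ^ m\<close> and the
    further shift of the exponent by m. The integral does not involve z, so the final constant is
    uniform.\<close>
  define D where "D = C * 2 ^ m * (LINT t:{0<..<1}|lborel. norm (W (x - real n - real m) t))"
  show thesis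
  proof
    fix z :: complex
    assume z: "- z \<notin> \<real>\<^sub>\<le>\<^sub>0" "norm z \<ge> 1"
      and \<delta>: "\<And>t. t \<in> {0<..<1} \<Longrightarrow> \<delta> \<le> norm (1 - inverse (z * of_real t))"
    define w where "w t = inverse (z * complex_of_real t)" for t
    have pt: "norm (\<rho> (w t) * W x t)
        \<le> C * 2 ^ m * norm (z powi (- int n)) * norm (W (x - real n - real m) t)"
      if t: "t \<in> {0<..<1}" for t
    proof -
      \<comment> \<open>The factor 1 is kept inside \<open>inverse\<close> to match
        \<open>inverse_power_mult_ext_Beta_kernel\<close> at z = 1 later on.\<close>
      have "1 + norm (w t) \<le> 2 * norm (inverse (1 * complex_of_real t))"
      proof -
        have "1 \<le> 1 / t" using t by simp
        moreover have "norm (w t) \<le> 1 / t"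
          using t z mult_right_mono[OF le_imp_inverse_le[of 1 "norm z"], of "1 / t"]
          by (simp add: w_def norm_inverse norm_mult divide_inverse)
        ultimately show ?thesis using t by (simp add: norm_inverse divide_inverse)
      qed
      then have "(1 + norm (w t)) ^ m \<le> 2 ^ m * norm (inverse (1 * complex_of_real t) ^ m)"
        unfolding norm_power power_mult_distrib[symmetric] by (intro power_mono) auto
      then have "norm (\<rho> (w t)) \<le>
          C * norm (w t ^ n) * (2 ^ m * norm (inverse (1 * complex_of_real t) ^ m))"
        using C(1) by (intro order_trans[OF C(2)[OF \<delta>[OF t], folded w_def]] mult_mono)
          (auto simp: norm_power)
      then have "norm (\<rho> (w t) * W x t) \<le>
          C * norm (w t ^ n) * (2 ^ m * norm (inverse (1 * complex_of_real t) ^ m)) * norm (W x t)"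
        unfolding norm_mult[of "\<rho> (w t)"] by (rule mult_right_mono) simp
      also have "\<dots> = C * 2 ^ m * norm (inverse (1 * complex_of_real t) ^ m * (w t ^ n * W x t))"
        by (simp add: norm_mult)
      also have "w t ^ n * W x t = z powi (- int n) * W (x - real n) t"
        unfolding w_def W_def by (rule inverse_power_mult_ext_Beta_kernel) (use t in auto)
      also have "inverse (1 * complex_of_real t) ^ m * (z powi (- int n) * W (x - real n) t)
          = z powi (- int n) * (inverse (1 * complex_of_real t) ^ m * W (x - real n) t)"
        by (simp only: mult.left_commute)
      also have "inverse (1 * complex_of_real t) ^ m * W (x - real n) t = W (x - real n - real m) t"
        unfolding W_def by (subst inverse_power_mult_ext_Beta_kernel) (use t in auto)
      finally show ?thesis by (simp add: norm_mult)
    qed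
    have int_bd: "set_integrable lborel {0<..<1}
        (\<lambda>t. C * 2 ^ m * norm (z powi (- int n)) * norm (W (x - real n - real m) t))"
      using W by (intro set_integrable_mult_right set_integrable_norm)
    \<comment> \<open>Continuity is proved for the sake of measurability. If 1 - 1/(z t) met the
      cut, 1/(z t) would be real and at least 1, making z a positive real. The base is in particular
      nonzero, so \<open>powr\<close> may be replaced by \<open>exp\<close> of \<open>Ln\<close>,
      avoiding its default value at 0.\<close>
    have "continuous_on {0<..<1} (\<lambda>t. \<rho> (w t))"
    proof -
      have nz: "z \<noteq> 0" using z by auto
      have nonpos: "1 - inverse (z * complex_of_real t) \<notin> \<real>\<^sub>\<le>\<^sub>0" if "t \<in> {0<..<1}" for t
      proof
        assume "1 - inverse (z * complex_of_real t) \<in> \<real>\<^sub>\<le>\<^sub>0"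
        then obtain q where q: "q \<le> 0" "1 - inverse (z * complex_of_real t) = of_real q"
          by (auto elim!: nonpos_Reals_cases)
        then have "inverse (z * of_real t) = of_real (1 - q)" by (simp add: algebra_simps)
        then have "z * of_real t = of_real (inverse (1 - q))"
          by (metis inverse_inverse_eq of_real_inverse)
        then have "- z = of_real (- (inverse (1 - q) / t))"
          using that by (simp add: eq_divide_eq)
        also have "\<dots> \<in> \<real>\<^sub>\<le>\<^sub>0"
          using q that by (subst nonpos_Reals_of_real_iff) simp
        finally show False using z by simp
      qed
      then have "1 - inverse (z * complex_of_real t) \<noteq> 0" if "t \<in> {0<..<1}" for t
        using that by fastforce
      then have "continuous_on {0<..<1} (\<lambda>t. \<rho> (w t)) \<longleftrightarrow> continuous_on {0<..<1}
          (\<lambda>t. exp (- of_real a * Ln (1 - inverse (z * complex_of_real t)))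
             - (\<Sum>k<n. f k * inverse (z * complex_of_real t) ^ k))"
        by (intro continuous_on_cong) (auto simp: \<rho>_def w_def powr_def)
      also have "\<dots>"
        by (intro continuous_intros nonpos) (use nz in auto)
      finally show ?thesis .
    qed
    then have "(\<lambda>t. indicator {0<..<1} t *\<^sub>R \<rho> (w t)) \<in> borel_measurable borel"
      by (intro borel_measurable_continuous_on_indicator) auto
    moreover have "(\<lambda>t. W x t) \<in> borel_measurable borel"
      unfolding W_def ext_Beta_kernel_def by measurable
    ultimately have "(\<lambda>t. (indicator {0<..<1} t *\<^sub>R \<rho> (w t)) * W x t) \<in> borel_measurable borel"
      by (rule borel_measurable_times)
    then have meas: "set_borel_measurable lborel {0<..<1} (\<lambda>t. \<rho> (w t) * W x t)"
      by (simp add: set_borel_measurable_def)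
    have int_\<rho>: "set_integrable lborel {0<..<1} (\<lambda>t. \<rho> (w t) * W x t)"
      by (rule set_integrable_bound[OF int_bd meas])
        (use pt in \<open>auto intro!: order_trans[OF _ abs_ge_self]\<close>)
    have "norm (LINT t:{0<..<1}|lborel. \<rho> (w t) * W x t)
        \<le> (LINT t:{0<..<1}|lborel. norm (\<rho> (w t) * W x t))"
      by (rule set_integral_norm_bound[OF int_\<rho>])
    also have "\<dots> \<le> (LINT t:{0<..<1}|lborel.
        C * 2 ^ m * norm (z powi (- int n)) * norm (W (x - real n - real m) t))"
      by (intro set_integral_mono set_integrable_norm int_\<rho> int_bd pt)
    also have "\<dots> = D * norm (z powi (- int n))"
      by (simp add: D_def)
    finally have bound: "norm (LINT t:{0<..<1}|lborel. \<rho> (w t) * W x t) \<le> D * norm (z powi (- int n))" .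
    have int_k: "set_integrable lborel {0<..<1} (\<lambda>t. \<Sum>k<n. f k * z powi (- int k) * W (x - real k) t)"
      unfolding set_integrable_def scaleR_sum_right
      by (intro Bochner_Integration.integrable_sum set_integrable_mult_right[unfolded set_integrable_def]
          W[unfolded set_integrable_def])
    \<comment> \<open>The n leading terms are integrated exactly; only the part with \<rho> is
      estimated.\<close>
    have "(LINT t:{0<..<1}|lborel. (1 - w t) powr (- of_real a) * W x t)
        = (LINT t:{0<..<1}|lborel. \<rho> (w t) * W x t + (\<Sum>k<n. f k * z powi (- int k) * W (x - real k) t))"
    proof (intro set_lebesgue_integral_cong ballI allI impI)
      fix t :: real assume t: "t \<in> {0<..<1}"
      have "w t ^ k * W x t = z powi (- int k) * W (x - real k) t" for k
        unfolding w_def W_def by (rule inverse_power_mult_ext_Beta_kernel) (use t in auto)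
      then have "(\<Sum>k<n. f k * z powi (- int k) * W (x - real k) t) = (\<Sum>k<n. f k * w t ^ k) * W x t"
        by (simp add: sum_distrib_right mult.assoc)
      then show "(1 - w t) powr (- of_real a) * W x t
          = \<rho> (w t) * W x t + (\<Sum>k<n. f k * z powi (- int k) * W (x - real k) t)"
        by (simp add: \<rho>_def algebra_simps)
    qed auto
    also have "\<dots> = (LINT t:{0<..<1}|lborel. \<rho> (w t) * W x t)
        + (LINT t:{0<..<1}|lborel. (\<Sum>k<n. f k * z powi (- int k) * W (x - real k) t))"
      by (intro set_integral_add int_\<rho> int_k)
    also have "(LINT t:{0<..<1}|lborel. (\<Sum>k<n. f k * z powi (- int k) * W (x - real k) t))
        = (\<Sum>k<n. f k * z powi (- int k) * (LINT t:{0<..<1}|lborel. W (x - real k) t))"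
      using set_integrable_mult_right[OF W]
      unfolding set_lebesgue_integral_def set_integrable_def scaleR_sum_right
      by (subst Bochner_Integration.integral_sum)
        (auto simp flip: mult_scaleR_right)
    finally have split: "(LINT t:{0<..<1}|lborel. (1 - w t) powr (- of_real a) * W x t)
      = (LINT t:{0<..<1}|lborel. \<rho> (w t) * W x t)
        + (\<Sum>k<n. f k * z powi (- int k) * (LINT t:{0<..<1}|lborel. W (x - real k) t))" .
    have "(\<Sum>k<n. f k * z powi (- int k) * ext_Beta (of_real \<nu>) (of_real (b - a - real k)) (of_real (c - b)) p)
        = S * (\<Sum>k<n. f k * z powi (- int k) * (LINT t:{0<..<1}|lborel. W (x - real k) t))"
      unfolding ext_Beta_eq_integral_kernel sum_distrib_left W_def S_def x_def
      by (simp add: algebra_simps)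
    moreover have "ext_hyp_integral p (of_real \<nu>) (of_real a) (of_real b) (of_real c) z
        = S * ((- z) powr (- of_real a) / B) * (LINT t:{0<..<1}|lborel. (1 - w t) powr (- of_real a) * W x t)"
      using ext_hyp_integral_eq_integral_kernel[OF z(1)]
      unfolding S_def B_def w_def W_def x_def .
    ultimately have "ext_hyp_integral p (of_real \<nu>) (of_real a) (of_real b) (of_real c) z
        - (- z) powr (- of_real a) / B *
        (\<Sum>k<n. f k * z powi (- int k) * ext_Beta (of_real \<nu>) (of_real (b - a - real k)) (of_real (c - b)) p)
      = S / B * ((- z) powr (- of_real a) * (LINT t:{0<..<1}|lborel. \<rho> (w t) * W x t))"
      unfolding split by (simp add: algebra_simps)
    also have "norm \<dots> \<le> norm (S / B) *
        (norm ((- z) powr (- of_real a)) * (D * norm (z powi (- int n))))"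
      unfolding norm_mult by (intro mult_left_mono bound) auto
    finally show "norm (ext_hyp_integral p (of_real \<nu>) (of_real a) (of_real b) (of_real c) z
      - (- z) powr (- of_real a) / Beta (of_real b) (of_real (c - b)) *
        (\<Sum>k<n. pochhammer (of_real a) k / fact k * z powi (- int k) *
           ext_Beta (of_real \<nu>) (of_real (b - a - real k)) (of_real (c - b)) p))
      \<le> (norm (S / B) * D) * norm ((- z) powr (- of_real a) * z powi (- int n))"
      by (simp add: f_def B_def norm_mult mult_ac)
  qed
qed

section \<open>The expansion at infinity in a sector\<close>

theorem theorem13:
  fixes n :: nat and p a b c \<nu> \<epsilon> :: real
  assumes "n > 0" and "p > 0" and "c > b" and "b > 0" and "\<epsilon> > 0"
  shows "let R = (\<lambda>z::complex.
             ext_hyp p (of_real \<nu>) (of_real a) (of_real b) (of_real c) z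
             - (- z) powr (- of_real a) / Beta (of_real b) (of_real (c - b)) *
               (\<Sum>k<n. pochhammer (of_real a) k / fact k * z powi (- int k) *
                  ext_Beta (of_real \<nu>) (of_real (b - a - real k)) (of_real (c - b)) p))
         in R \<in> O[at_infinity_sector \<epsilon>](\<lambda>z. (- z) powr (- of_real a) * z powi (- int n)) \<and>
            (a \<ge> 0 \<longrightarrow> R \<in> O[at_infinity_sector \<epsilon>](\<lambda>z. z powi (- int n)))"
proof -
  define R where "R = (\<lambda>z::complex.
             ext_hyp p (of_real \<nu>) (of_real a) (of_real b) (of_real c) z
             - (- z) powr (- of_real a) / Beta (of_real b) (of_real (c - b)) *
               (\<Sum>k<n. pochhammer (of_real a) k / fact k * z powi (- int k) *
                  ext_Beta (of_real \<nu>) (of_real (b - a - real k)) (of_real (c - b)) p))"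
  \<comment> \<open>Capping \<epsilon> at \<pi>/2 only enlarges the sector and guarantees that the
    sine is positive.\<close>
  define \<eta> where "\<eta> = min \<epsilon> (pi / 2)"
  have \<eta>: "0 < \<eta>" "\<eta> \<le> pi / 2" using assms by (auto simp: \<eta>_def)
  have "sin \<eta> > 0" using \<eta> by (intro sin_gt_zero) auto
  from ext_hyp_integral_remainder[OF \<open>p > 0\<close> this,
      where a = a and b = b and c = c and \<nu> = \<nu> and n = n]
  obtain C where C: "\<And>z. - z \<notin> \<real>\<^sub>\<le>\<^sub>0 \<Longrightarrow> norm z \<ge> 1 \<Longrightarrow>
    (\<And>t. t \<in> {0<..<1} \<Longrightarrow> sin \<eta> \<le> norm (1 - inverse (z * of_real t))) \<Longrightarrow>
    norm (ext_hyp_integral p (of_real \<nu>) (of_real a) (of_real b) (of_real c) z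
      - (- z) powr (- of_real a) / Beta (of_real b) (of_real (c - b)) *
        (\<Sum>k<n. pochhammer (of_real a) k / fact k * z powi (- int k) *
           ext_Beta (of_real \<nu>) (of_real (b - a - real k)) (of_real (c - b)) p))
    \<le> C * norm ((- z) powr (- of_real a) * z powi (- int n))"
    by blast
  \<comment> \<open>Norm at least 1 also selects the integral branch in the definition of
    \<open>ext_hyp\<close>.\<close>
  have ev: "eventually (\<lambda>z. norm z \<ge> 1 \<and> \<bar>Arg (- z)\<bar> \<le> pi - \<epsilon>) (at_infinity_sector \<epsilon>)"
    unfolding at_infinity_sector_def eventually_inf_principal eventually_at_infinity by auto
  have "eventually (\<lambda>z. norm (R z) \<le> C * norm ((- z) powr (- of_real a) * z powi (- int n)))
      (at_infinity_sector \<epsilon>)"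
    using ev
  proof eventually_elim
    case (elim z)
    then have z: "norm z \<ge> 1" "\<bar>Arg (- z)\<bar> \<le> pi - \<eta>" by (auto simp: \<eta>_def)
    then have "z \<noteq> 0" "Arg (- z) \<noteq> pi" using \<eta> by auto
    then have np: "- z \<notin> \<real>\<^sub>\<le>\<^sub>0"
      by (auto simp: complex_nonpos_Reals_iff Arg_eq_pi complex_eq_iff order_le_less)
    have "sin \<eta> \<le> norm (1 - inverse (z * of_real t))" if "t \<in> {0<..<1}" for t
    proof -
      \<comment> \<open>Scaling by t > 0 preserves the argument and inversion preserves its absolute
        value, so u = -1/(z t) lies in the same sector as -z, and 1 - 1/(z t) = 1 + u.\<close>
      have "\<bar>Arg (inverse (- z * of_real t))\<bar> = \<bar>Arg (- z)\<bar>"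
        unfolding Arg_inverse using that Arg_times_of_real2[of t "- z"] by (auto simp del: mult_minus_left)
      then have "sin \<eta> \<le> norm (1 + inverse (- z * of_real t))"
        using z \<eta> by (intro norm_one_plus_sector_ge) auto
      then show ?thesis by simp
    qed
    from C[OF np z(1) this] show ?case
      using z by (simp add: R_def ext_hyp_def)
  qed
  then have R: "R \<in> O[at_infinity_sector \<epsilon>](\<lambda>z. (- z) powr (- of_real a) * z powi (- int n))"
    by (rule bigoI)
  \<comment> \<open>The prefactor has norm |z|^(-a), at most 1 here since a \<ge> 0 and |z| \<ge> 1.
    For a < 0 it grows, and the estimate relative to it is the one obtained for every real
    a.\<close>
  moreover have "R \<in> O[at_infinity_sector \<epsilon>](\<lambda>z. z powi (- int n))" if "a \<ge> 0"
  proof (rule landau_o.big_trans[OF R], rule bigoI[of _ 1], use ev in eventually_elim)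
    case (elim z)
    have "norm ((- z) powr (- of_real a)) = norm z powr (- a)"
      by (subst norm_powr_real_powr') auto
    also have "\<dots> \<le> norm z powr 0"
      using elim that by (intro powr_mono) auto
    also have "\<dots> \<le> 1" by simp
    finally show ?case
      by (simp add: norm_mult mult_left_le_one_le)
  qed
  ultimately show ?thesis
    unfolding Let_def R_def[symmetric] by (intro conjI impI)
qed

end
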